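(* Let $D>0$, $L>0$, $\theta\in(-\pi/2,\pi/2)$ and $S>0$. Let $\gamma_1\ge\gamma_2\ge\gamma_3$ be the eigenvalues (all positive) of the matrix $\overline{\mathcal{W}}^{3\times3}$ defined in the context, let $\vartheta>0$ be the unique solution of the waterfilling equation $$S=\sum_{i=1}^{3}\left[\frac1\vartheta-\frac{\psi_2}{\gamma_i}\right]^+,$$ let $s_i=\left[\frac1\vartheta-\frac{\psi_2}{\gamma_i}\right]^+$ for $i=1,2,3$, and let $n_+$ be the number of indices $i$ with $s_i\neq0$. Put $\Delta=\sqrt{(D^2-L^2)^2+(2LD\cos\theta)^2}$ and $$S^{(1)}=\frac{\psi_2}{\gamma_2}-\frac{\psi_2}{\gamma_1}=\frac{\psi_2\Delta-1}{\psi_2\Delta+1},\qquad S^{(2)}=\frac{2\psi_2}{\gamma_3}-\frac{\psi_2}{\gamma_1}-\frac{\psi_2}{\gamma_2}=\frac{\psi_2\Delta-1}{\psi_2\Delta+1}+\frac{8\psi_2\Delta}{(\psi_2\Delta)^2-1}.$$ Then $n_+=1$ if $S<S^{(1)}$; $n_+=2$ if $S^{(1)}\le S<S^{(2)}$; and $n_+=3$ if $S^{(2)}\le S$.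
   Context: Here $[x]^+=\max(x,0)$. For $D>0$, $L>0$, $\theta\in(-\pi/2,\pi/2)$ define $$\Gamma=\arctan\frac{L/D-\sin\theta}{\cos\theta}+\arctan\frac{L/D+\sin\theta}{\cos\theta},\qquad \psi_2=\frac{\Gamma}{2LD\cos\theta},$$ $$\bar\psi_3=-\frac{D\sin\theta}{(D^2+L^2)^2-(2LD\sin\theta)^2},$$ $$\psi_4=\frac{1}{2(D\cos\theta)^2}\left[\frac{(D^2+L^2)-2D^2\sin^2\theta}{(D^2+L^2)^2-(2LD\sin\theta)^2}+\psi_2\right],$$ $$\overline{\mathcal{W}}^{3\times3}=\begin{bmatrix}\psi_2&0&0\\0&\psi_4D^2\cos^2\theta&\bar\psi_3D\cos\theta\\0&\bar\psi_3D\cos\theta&\psi_2-\psi_4D^2\cos^2\theta\end{bmatrix}.$$ Interpretation: $S$ is the asymptotic received SNR $\overline{\mathsf{SNR}}_{RX}$, $S^{(i)}$ are the activation thresholds $\overline{\mathsf{SNR}}^{(i)}$, and $n_+$ is the optimal number of spatial streams when transmitter and receiver both use three polarizations.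
   Formalization: At S=S^(1) and S=S^(2) the newly activated stream has power 0, so n_+ is 1 and 2 there, not 2 and 3; proved instead: n_+=1 if S≤S^(1), n_+=2 if S^(1)<S≤S^(2), n_+=3 if S^(2)<S. *)

theory Defs
  imports "HOL-Analysis.Analysis" "Jordan_Normal_Form.Char_Poly"
begin

definition Gam :: "real \<Rightarrow> real \<Rightarrow> real \<Rightarrow> real" where
  "Gam D L \<theta> = arctan ((L / D - sin \<theta>) / cos \<theta>) + arctan ((L / D + sin \<theta>) / cos \<theta>)"

definition psi2 :: "real \<Rightarrow> real \<Rightarrow> real \<Rightarrow> real" where
  "psi2 D L \<theta> = Gam D L \<theta> / (2 * L * D * cos \<theta>)"

definition psi3bar :: "real \<Rightarrow> real \<Rightarrow> real \<Rightarrow> real" where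
  "psi3bar D L \<theta> = - (D * sin \<theta> / ((D\<^sup>2 + L\<^sup>2)\<^sup>2 - (2 * L * D * sin \<theta>)\<^sup>2))"

definition psi4 :: "real \<Rightarrow> real \<Rightarrow> real \<Rightarrow> real" where
  "psi4 D L \<theta> = 1 / (2 * (D * cos \<theta>)\<^sup>2) *
     (((D\<^sup>2 + L\<^sup>2) - 2 * D\<^sup>2 * (sin \<theta>)\<^sup>2) / ((D\<^sup>2 + L\<^sup>2)\<^sup>2 - (2 * L * D * sin \<theta>)\<^sup>2) + psi2 D L \<theta>)"

definition W33 :: "real \<Rightarrow> real \<Rightarrow> real \<Rightarrow> real mat" where
  "W33 D L \<theta> = mat_of_rows_list 3
     [[psi2 D L \<theta>, 0, 0],
      [0, psi4 D L \<theta> * D\<^sup>2 * (cos \<theta>)\<^sup>2, psi3bar D L \<theta> * D * cos \<theta>],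
      [0, psi3bar D L \<theta> * D * cos \<theta>, psi2 D L \<theta> - psi4 D L \<theta> * D\<^sup>2 * (cos \<theta>)\<^sup>2]]"

definition Delta :: "real \<Rightarrow> real \<Rightarrow> real \<Rightarrow> real" where
  "Delta D L \<theta> = sqrt ((D\<^sup>2 - L\<^sup>2)\<^sup>2 + (2 * L * D * cos \<theta>)\<^sup>2)"

(* The factorisation of char_poly lists the eigenvalues with algebraic multiplicity. *)
definition ordered_eigenvalues3 :: "real mat \<Rightarrow> (nat \<Rightarrow> real) \<Rightarrow> bool" where
  "ordered_eigenvalues3 A \<gamma> \<longleftrightarrow>
     char_poly A = (\<Prod>i = 1..3. [:- \<gamma> i, 1:]) \<and> \<gamma> 1 \<ge> \<gamma> 2 \<and> \<gamma> 2 \<ge> \<gamma> 3"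

definition stream_power :: "real \<Rightarrow> (nat \<Rightarrow> real) \<Rightarrow> real \<Rightarrow> nat \<Rightarrow> real" where
  "stream_power \<psi> \<gamma> \<mu> i = max (1 / \<mu> - \<psi> / \<gamma> i) 0"

definition waterfilling_solution :: "real \<Rightarrow> real \<Rightarrow> (nat \<Rightarrow> real) \<Rightarrow> real \<Rightarrow> bool" where
  "waterfilling_solution S \<psi> \<gamma> \<mu> \<longleftrightarrow> \<mu> > 0 \<and> S = (\<Sum>i = 1..3. stream_power \<psi> \<gamma> \<mu> i)"

(* When S equals an activation threshold, the newly activated stream has power exactly 0 and
   is not counted here; so the count jumps just above each threshold, not at it. *)
definition n_streams :: "real \<Rightarrow> (nat \<Rightarrow> real) \<Rightarrow> real \<Rightarrow> nat" where
  "n_streams \<psi> \<gamma> \<mu> = card {i \<in> {1..3}. stream_power \<psi> \<gamma> \<mu> i \<noteq> 0}"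

end

theory Submission
  imports Defs
begin

text \<open>
  The block form of the matrix gives the eigenvalues \<open>\<psi>\<^sub>2\<close> and
  \<open>\<psi>\<^sub>2 / 2 \<plusminus> 1 / (2 \<Delta>)\<close>. They are positive and distinct because
  \<open>\<psi>\<^sub>2 \<Delta> > 1\<close>, which is the inequality \<open>\<Gamma> > sin \<Gamma>\<close> in disguise: the
  addition theorem yields \<open>sin \<Gamma> = 2 L D cos \<theta> / \<Delta>\<close>. In terms of the water level
  \<open>1 / \<vartheta>\<close> the total power is piecewise linear, with breakpoints where the level reaches
  \<open>\<psi>\<^sub>2 / \<gamma>\<^sub>i\<close>; the thresholds are its values at the second and third breakpoint.
\<close>

section \<open>Trigonometry of \<open>Gam\<close>: the inequality
  \<open>psi2 * Delta > 1\<close>\<close>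

lemma sin_less_self:
  fixes x :: real
  assumes "0 < x" "x < pi"
  shows "sin x < x"
proof -
  \<comment> \<open>The bound \<open>sin_x_le_x\<close> is not strict; applied at x / 2 in the
    double-angle formula it becomes strict through the factor cos (x / 2) < 1.\<close>
  have "sin (x / 2) > 0"
    using assms by (intro sin_gt_zero) auto
  moreover have "cos (x / 2) < 1"
    using cos_monotone_0_pi[of 0 "x / 2"] assms by simp
  ultimately have "sin (x / 2) * cos (x / 2) < sin (x / 2) * 1"
    by (intro mult_strict_left_mono)
  moreover have "sin x = 2 * (sin (x / 2) * cos (x / 2))"
    using sin_double[of "x / 2"] by simp
  moreover have "sin (x / 2) \<le> x / 2"
    using assms by (intro sin_x_le_x) simp
  ultimately show ?thesis by simp
qed

lemma sin_arctan_add: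
  "sin (arctan x + arctan y) = (x + y) / sqrt ((1 + x\<^sup>2) * (1 + y\<^sup>2))"
  by (simp add: sin_add sin_arctan cos_arctan real_sqrt_mult add_divide_distrib)

lemma Delta_pos:
  assumes "D > 0" "L > 0" "cos \<theta> > 0"
  shows "Delta D L \<theta> > 0"
proof -
  have "(D\<^sup>2 - L\<^sup>2)\<^sup>2 + (2 * L * D * cos \<theta>)\<^sup>2 > 0"
    using assms by (intro add_nonneg_pos) auto
  then show ?thesis by (simp add: Delta_def)
qed

text \<open>The right-hand side is the common denominator in \<open>psi3bar\<close> and
  \<open>psi4\<close>; being a difference of squares, it also splits into the two factors that occur
  in \<open>sin_Gam\<close>.\<close>

lemma Delta_squared:
  "(Delta D L \<theta>)\<^sup>2 = (D\<^sup>2 + L\<^sup>2)\<^sup>2 - (2 * L * D * sin \<theta>)\<^sup>2"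
proof -
  have "(2 * L * D * cos \<theta>)\<^sup>2 = (2 * L * D)\<^sup>2 - (2 * L * D * sin \<theta>)\<^sup>2"
    by (simp add: power_mult_distrib cos_squared_eq right_diff_distrib)
  moreover have "(Delta D L \<theta>)\<^sup>2 = (D\<^sup>2 - L\<^sup>2)\<^sup>2 + (2 * L * D * cos \<theta>)\<^sup>2"
    unfolding Delta_def by (intro real_sqrt_pow2) simp
  ultimately show ?thesis
    by (simp add: power2_eq_square algebra_simps)
qed

lemma sin_Gam:
  assumes "D > 0" "L > 0" "cos \<theta> > 0"
  shows "sin (Gam D L \<theta>) = 2 * L * D * cos \<theta> / Delta D L \<theta>"
proof -
  define x y where "x = (L / D - sin \<theta>) / cos \<theta>" and "y = (L / D + sin \<theta>) / cos \<theta>"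
  have sc: "(cos \<theta>)\<^sup>2 = 1 - (sin \<theta>)\<^sup>2"
    by (rule cos_squared_eq)
  have "1 + x\<^sup>2 = ((cos \<theta>)\<^sup>2 + (L / D - sin \<theta>)\<^sup>2) / (cos \<theta>)\<^sup>2"
    unfolding x_def power_divide using assms by (simp add: field_simps)
  also have "(cos \<theta>)\<^sup>2 + (L / D - sin \<theta>)\<^sup>2 = (D\<^sup>2 + L\<^sup>2 - 2 * L * D * sin \<theta>) / D\<^sup>2"
    unfolding sc using assms by (simp add: field_simps power2_eq_square)
  finally have x: "1 + x\<^sup>2 = (D\<^sup>2 + L\<^sup>2 - 2 * L * D * sin \<theta>) / (D * cos \<theta>)\<^sup>2"
    by (simp add: power_mult_distrib)
  have "1 + y\<^sup>2 = ((cos \<theta>)\<^sup>2 + (L / D + sin \<theta>)\<^sup>2) / (cos \<theta>)\<^sup>2"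
    unfolding y_def power_divide using assms by (simp add: field_simps)
  also have "(cos \<theta>)\<^sup>2 + (L / D + sin \<theta>)\<^sup>2 = (D\<^sup>2 + L\<^sup>2 + 2 * L * D * sin \<theta>) / D\<^sup>2"
    unfolding sc using assms by (simp add: field_simps power2_eq_square)
  finally have y: "1 + y\<^sup>2 = (D\<^sup>2 + L\<^sup>2 + 2 * L * D * sin \<theta>) / (D * cos \<theta>)\<^sup>2"
    by (simp add: power_mult_distrib)
  \<comment> \<open>The numerators of \<open>x\<close> and \<open>y\<close> are the conjugate
    factors D^2 + L^2 -/+ 2 L D sin \<theta> of the squared \<open>Delta\<close>.\<close>
  have "(1 + x\<^sup>2) * (1 + y\<^sup>2) = (Delta D L \<theta>)\<^sup>2 / ((D * cos \<theta>)\<^sup>2)\<^sup>2"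
    unfolding x y Delta_squared by (simp add: power2_eq_square algebra_simps)
  then have "sqrt ((1 + x\<^sup>2) * (1 + y\<^sup>2)) = Delta D L \<theta> / (D * cos \<theta>)\<^sup>2"
    using Delta_pos[OF assms] by (simp add: real_sqrt_divide del: power_mult_numeral power_even_eq)
  moreover have "x + y = 2 * L / (D * cos \<theta>)"
    using assms by (simp add: x_def y_def field_simps)
  ultimately have "sin (arctan x + arctan y)
      = (2 * L / (D * cos \<theta>)) / (Delta D L \<theta> / (D * cos \<theta>)\<^sup>2)"
    by (simp only: sin_arctan_add)
  then show ?thesis
    using assms Delta_pos[OF assms]
    by (simp add: Gam_def x_def y_def power2_eq_square)
qed

lemma sin_Gam_less_Gam:
  assumes "D > 0" "L > 0" "cos \<theta> > 0"
  shows "sin (Gam D L \<theta>) < Gam D L \<theta>"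
proof (rule sin_less_self)
  \<comment> \<open>One of the two arguments may be negative, so the sum is handled as a whole: the
    arguments add up to 2 L / (D cos \<theta>) > 0, and arctan is odd and strictly
    increasing.\<close>
  have "- ((L / D - sin \<theta>) / cos \<theta>) < (L / D + sin \<theta>) / cos \<theta>"
    using assms by (simp add: field_simps)
  then have "arctan (- ((L / D - sin \<theta>) / cos \<theta>)) < arctan ((L / D + sin \<theta>) / cos \<theta>)"
    by (simp only: arctan_less_iff)
  then show "0 < Gam D L \<theta>"
    by (simp add: Gam_def arctan_minus del: minus_divide_left)
  show "Gam D L \<theta> < pi"
    using arctan_ubound[of "(L / D - sin \<theta>) / cos \<theta>"]
      arctan_ubound[of "(L / D + sin \<theta>) / cos \<theta>"]
    by (simp add: Gam_def)
qed

lemma psi2_Delta_gt_1: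
  assumes "D > 0" "L > 0" "cos \<theta> > 0"
  shows "psi2 D L \<theta> * Delta D L \<theta> > 1"
proof -
  have "2 * L * D * cos \<theta> < Gam D L \<theta> * Delta D L \<theta>"
    using sin_Gam_less_Gam[OF assms] Delta_pos[OF assms]
    by (simp add: sin_Gam[OF assms] divide_less_eq)
  then show ?thesis
    using assms by (simp add: psi2_def less_divide_eq)
qed

section \<open>Eigenvalues of the block matrix\<close>

lemma poly_char_poly_block3:
  fixes p a b c d x :: real
  shows "poly (char_poly (mat_of_rows_list 3 [[p, 0, 0], [0, a, b], [0, c, d]])) x =
    (x - p) * ((x - a) * (x - d) - b * c)"
proof -
  define A where "A = mat_of_rows_list 3 [[p, 0, 0], [0, a, b], [0, c, d]]"
  define C where "C = char_poly_matrix A"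
  have C: "C \<in> carrier_mat 3 3"
    unfolding C_def A_def mat_of_rows_list_def char_poly_matrix_def by (intro carrier_matI) auto
  have det2: "Determinant.det M = M $$ (0, 0) * M $$ (1, 1) - M $$ (0, 1) * M $$ (1, 0)"
    if M: "M \<in> carrier_mat 2 2" for M :: "real poly mat"
  proof -
    have "Determinant.det (mat_delete M 0 j) = mat_delete M 0 j $$ (0, 0)" for j
      using M by (intro det_single) (simp add: mat_delete_def)
    then show ?thesis
      using M
      by (simp add: laplace_expansion_row[OF M, of 0] numeral_2_eq_2 cofactor_def mat_delete_def)
  qed
  have entries: "C $$ (0, 0) = [:- p, 1:]" "C $$ (0, 1) = 0" "C $$ (0, 2) = 0"
    "C $$ (1, 1) = [:- a, 1:]" "C $$ (1, 2) = [:- b:]"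
    "C $$ (2, 1) = [:- c:]" "C $$ (2, 2) = [:- d, 1:]"
    by (simp_all add: C_def char_poly_matrix_def A_def mat_of_rows_list_def)
  \<comment> \<open>The first row of \<open>C\<close> vanishes off the diagonal, so a single
    cofactor survives.\<close>
  have "Determinant.det C = (\<Sum>j<3. C $$ (0, j) * cofactor C 0 j)"
    by (intro laplace_expansion_row C) simp
  also have "\<dots> = [:- p, 1:] * Determinant.det (mat_delete C 0 0)"
    using entries(1-3) by (simp add: numeral_3_eq_3 numeral_2_eq_2 cofactor_def)
  also have "Determinant.det (mat_delete C 0 0) =
      C $$ (1, 1) * C $$ (2, 2) - C $$ (1, 2) * C $$ (2, 1)"
  proof -
    have "mat_delete C 0 0 \<in> carrier_mat 2 2"
      using mat_delete_carrier[OF C] by simp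
    then show ?thesis
      using C by (simp add: det2 mat_delete_def numeral_2_eq_2)
  qed
  finally have "Determinant.det C = [:- p, 1:] * ([:- a, 1:] * [:- d, 1:] - [:- b:] * [:- c:])"
    by (simp only: entries)
  \<comment> \<open>The deleted rules would multiply the linear polynomials out; without them
    \<open>poly_mult\<close> evaluates factor by factor.\<close>
  then show ?thesis
    by (simp add: char_poly_def A_def C_def poly_mult del: mult_pCons_left mult_pCons_right)
qed

text \<open>The lower block has trace \<psi>, so it is \<psi> / 2 times the identity plus the
  traceless symmetric matrix with rows (p, b) and (b, -p). The eigenvalues of the latter are the two
  square roots of p^2 + b^2, which is 1 / (2 \<Delta>) squared.\<close>

lemma W33_eigenvalues:
  assumes "D > 0" "L > 0" "cos \<theta> > 0"
  defines "\<psi> \<equiv> psi2 D L \<theta>" and "\<Delta> \<equiv> Delta D L \<theta>"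
  shows "poly (char_poly (W33 D L \<theta>)) x =
    (x - \<psi>) * (x - (\<psi> + 1 / \<Delta>) / 2) * (x - (\<psi> - 1 / \<Delta>) / 2)"
proof -
  define p where "p = (D\<^sup>2 + L\<^sup>2 - 2 * D\<^sup>2 * (sin \<theta>)\<^sup>2) / (2 * \<Delta>\<^sup>2)"
  define b where "b = psi3bar D L \<theta> * D * cos \<theta>"
  have Q: "(D\<^sup>2 + L\<^sup>2)\<^sup>2 - (2 * L * D * sin \<theta>)\<^sup>2 = \<Delta>\<^sup>2"
    by (simp add: \<Delta>_def Delta_squared)
  have \<Delta>: "\<Delta> > 0"
    using Delta_pos[OF assms(1-3)] by (simp add: \<Delta>_def)
  have a: "psi4 D L \<theta> * D\<^sup>2 * (cos \<theta>)\<^sup>2 = \<psi> / 2 + p"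
    using assms(1-3) \<Delta> unfolding psi4_def Q p_def \<psi>_def[symmetric]
    by (simp add: field_simps)
  have b: "b = - (D\<^sup>2 * sin \<theta> * cos \<theta>) / \<Delta>\<^sup>2"
    unfolding b_def psi3bar_def Q by (simp add: power2_eq_square)
  \<comment> \<open>By double angles the two squared terms are those of L^2 + D^2 cos 2\<theta> and
    D^2 sin 2\<theta>; both sides equal D^4 + L^4 + 2 L^2 D^2 cos 2\<theta>.\<close>
  have "(D\<^sup>2 + L\<^sup>2 - 2 * D\<^sup>2 * (sin \<theta>)\<^sup>2)\<^sup>2 + 4 * (D\<^sup>2 * sin \<theta> * cos \<theta>)\<^sup>2 = \<Delta>\<^sup>2"
    unfolding Q[symmetric] power_mult_distrib cos_squared_eq
    by (simp add: power2_eq_square algebra_simps)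
  then have "p\<^sup>2 + b\<^sup>2 = \<Delta>\<^sup>2 / (4 * (\<Delta>\<^sup>2)\<^sup>2)"
    unfolding p_def b using \<Delta> by (simp add: field_simps power2_eq_square)
  then have pb: "p\<^sup>2 + b\<^sup>2 = (1 / (2 * \<Delta>))\<^sup>2"
    using \<Delta> by (simp add: power2_eq_square field_simps)
  have "poly (char_poly (W33 D L \<theta>)) x =
      (x - \<psi>) * ((x - (\<psi> / 2 + p)) * (x - (\<psi> - (\<psi> / 2 + p))) - b * b)"
    unfolding W33_def \<psi>_def[symmetric] a b_def[symmetric] by (rule poly_char_poly_block3)
  also have "(x - (\<psi> / 2 + p)) * (x - (\<psi> - (\<psi> / 2 + p))) - b * b
      = (x - \<psi> / 2)\<^sup>2 - (p\<^sup>2 + b\<^sup>2)"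
    by (simp add: power2_eq_square field_simps)
  also have "\<dots> = (x - (\<psi> + 1 / \<Delta>) / 2) * (x - (\<psi> - 1 / \<Delta>) / 2)"
  proof -
    have "(x - \<psi> / 2)\<^sup>2 - (e / 2)\<^sup>2 = (x - (\<psi> + e) / 2) * (x - (\<psi> - e) / 2)" for e
      by (simp add: power2_eq_square field_simps)
    from this[of "1 / \<Delta>"] show ?thesis
      unfolding pb by (simp add: mult.commute)
  qed
  finally show ?thesis
    by (simp only: mult.assoc)
qed

text \<open>Values of the characteristic polynomial suffice: each \<open>e\<close> is a root, hence
  one of the \<gamma>s, and three distinct values in strict order leave only one ordered
  assignment.\<close>

lemma ordered_eigenvalues3_unique:
  assumes "ordered_eigenvalues3 A \<gamma>"
    and "\<And>x. poly (char_poly A) x = (x - e1) * (x - e2) * (x - e3)"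
    and "e1 > e2" "e2 > e3"
  shows "\<gamma> 1 = e1" "\<gamma> 2 = e2" "\<gamma> 3 = e3"
proof -
  have "char_poly A = [:- \<gamma> 1, 1:] * [:- \<gamma> 2, 1:] * [:- \<gamma> 3, 1:]"
    and ord: "\<gamma> 1 \<ge> \<gamma> 2" "\<gamma> 2 \<ge> \<gamma> 3"
    using assms(1) by (simp_all add: ordered_eigenvalues3_def numeral_3_eq_3 numeral_2_eq_2)
  then have "(x - \<gamma> 1) * (x - \<gamma> 2) * (x - \<gamma> 3) = (x - e1) * (x - e2) * (x - e3)" for x
    using assms(2)[of x] by (simp del: mult_pCons_left mult_pCons_right add: poly_mult)
  from this[of e1] this[of e2] this[of e3]
  have "e1 \<in> {\<gamma> 1, \<gamma> 2, \<gamma> 3}" "e2 \<in> {\<gamma> 1, \<gamma> 2, \<gamma> 3}" "e3 \<in> {\<gamma> 1, \<gamma> 2, \<gamma> 3}"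
    by auto
  with ord assms(3,4) show "\<gamma> 1 = e1" "\<gamma> 2 = e2" "\<gamma> 3 = e3"
    by auto
qed

section \<open>Waterfilling in terms of the level \<open>1 / \<mu>\<close>\<close>

lemma waterfilling_solution_iff:
  "waterfilling_solution S \<psi> \<gamma> \<mu> \<longleftrightarrow> \<mu> > 0 \<and>
    S = max (1 / \<mu> - \<psi> / \<gamma> 1) 0 + max (1 / \<mu> - \<psi> / \<gamma> 2) 0 + max (1 / \<mu> - \<psi> / \<gamma> 3) 0"
  by (simp add: waterfilling_solution_def stream_power_def numeral_3_eq_3 numeral_2_eq_2)

lemma ex1_waterfilling_solution:
  assumes "0 < \<psi> / \<gamma> 1" "\<psi> / \<gamma> 1 \<le> \<psi> / \<gamma> 2" "\<psi> / \<gamma> 2 \<le> \<psi> / \<gamma> 3" "S > 0"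
  shows "\<exists>!\<mu>. waterfilling_solution S \<psi> \<gamma> \<mu>"
proof -
  define c1 c2 c3 where c: "c1 = \<psi> / \<gamma> 1" "c2 = \<psi> / \<gamma> 2" "c3 = \<psi> / \<gamma> 3"
  have c_ord: "0 < c1" "c1 \<le> c2" "c2 \<le> c3"
    using assms unfolding c by auto
  define P where "P t = max (t - c1) 0 + max (t - c2) 0 + max (t - c3) 0" for t
  have "\<exists>t>0. P t = S"
  proof -
    \<comment> \<open>The case bounds are P c2 and P c3. Each case inverts the linear piece of
      \<open>P\<close> on which one, two or three terms are positive.\<close>
    consider "S \<le> c2 - c1" | "c2 - c1 < S" "S \<le> 2 * c3 - c1 - c2" | "2 * c3 - c1 - c2 < S"
      by linarith
    then show ?thesis
    proof cases
      case 1
      then have "P (S + c1) = S" "S + c1 > 0"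
        using c_ord \<open>S > 0\<close> by (auto simp: P_def max_def)
      then show ?thesis by blast
    next
      case 2
      then have "P ((S + c1 + c2) / 2) = S" "(S + c1 + c2) / 2 > 0"
        using c_ord \<open>S > 0\<close> by (auto simp: P_def max_def field_simps)
      then show ?thesis by blast
    next
      case 3
      then have "P ((S + c1 + c2 + c3) / 3) = S" "(S + c1 + c2 + c3) / 3 > 0"
        using c_ord \<open>S > 0\<close> by (auto simp: P_def max_def field_simps)
      then show ?thesis by blast
    qed
  qed
  then obtain t where t: "t > 0" "P t = S" by blast
  \<comment> \<open>Since S > 0, both levels lie above \<open>c1\<close>, where \<open>P\<close> is
    strictly increasing; the flat piece below \<open>c1\<close> is excluded.\<close>
  have uniq: "u = t" if "P u = S" for u
    using that t(2) \<open>S > 0\<close> c_ord by (auto simp: P_def max_def split: if_splits)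
  have iff: "waterfilling_solution S \<psi> \<gamma> \<mu> \<longleftrightarrow> \<mu> > 0 \<and> S = P (1 / \<mu>)" for \<mu>
    by (simp add: waterfilling_solution_iff P_def c)
  show ?thesis
  proof (rule ex1I)
    show "waterfilling_solution S \<psi> \<gamma> (1 / t)"
      using t by (simp add: iff)
    show "\<mu> = 1 / t" if "waterfilling_solution S \<psi> \<gamma> \<mu>" for \<mu>
      using that uniq[of "1 / \<mu>"] t by (auto simp: iff field_simps)
  qed
qed

lemma n_streams_eq:
  "n_streams \<psi> \<gamma> \<mu> = (if \<psi> / \<gamma> 1 < 1 / \<mu> then 1 else 0)
    + (if \<psi> / \<gamma> 2 < 1 / \<mu> then 1 else 0) + (if \<psi> / \<gamma> 3 < 1 / \<mu> then 1 else 0)"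
proof -
  have "stream_power \<psi> \<gamma> \<mu> i \<noteq> 0 \<longleftrightarrow> \<psi> / \<gamma> i < 1 / \<mu>" for i
    by (simp add: stream_power_def max_def)
  then have "n_streams \<psi> \<gamma> \<mu> = (\<Sum>i = 1..3. if \<psi> / \<gamma> i < 1 / \<mu> then 1 else 0)"
    by (simp only: n_streams_def card_eq_sum sum.inter_filter finite_atLeastAtMost)
  then show ?thesis
    by (simp add: numeral_3_eq_3 numeral_2_eq_2)
qed

lemma n_streams_thresholds:
  assumes "\<psi> / \<gamma> 1 \<le> \<psi> / \<gamma> 2" "\<psi> / \<gamma> 2 \<le> \<psi> / \<gamma> 3" "S > 0"
    and "waterfilling_solution S \<psi> \<gamma> \<mu>"
  defines "S1 \<equiv> \<psi> / \<gamma> 2 - \<psi> / \<gamma> 1" and "S2 \<equiv> 2 * \<psi> / \<gamma> 3 - \<psi> / \<gamma> 1 - \<psi> / \<gamma> 2"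
  shows "S \<le> S1 \<Longrightarrow> n_streams \<psi> \<gamma> \<mu> = 1"
    and "S1 < S \<Longrightarrow> S \<le> S2 \<Longrightarrow> n_streams \<psi> \<gamma> \<mu> = 2"
    and "S2 < S \<Longrightarrow> n_streams \<psi> \<gamma> \<mu> = 3"
proof -
  define t c1 c2 c3 where c: "t = 1 / \<mu>" "c1 = \<psi> / \<gamma> 1" "c2 = \<psi> / \<gamma> 2" "c3 = \<psi> / \<gamma> 3"
  have S: "S = max (t - c1) 0 + max (t - c2) 0 + max (t - c3) 0"
    using assms(4) by (simp add: waterfilling_solution_iff c)
  have n: "n_streams \<psi> \<gamma> \<mu> = (if c1 < t then 1 else 0) + (if c2 < t then 1 else 0)
      + (if c3 < t then 1 else 0)"
    by (simp add: n_streams_eq c)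
  have c_ord: "c1 \<le> c2" "c2 \<le> c3"
    using assms(1,2) by (simp_all add: c)
  have S12: "S1 = c2 - c1" "S2 = 2 * c3 - c1 - c2"
    by (simp_all add: S1_def S2_def c)
  have "c1 < t"
    using S c_ord \<open>S > 0\<close> by (simp add: max_def split: if_splits)
  \<comment> \<open>\<open>S1\<close> and \<open>S2\<close> are the total powers at levels
    \<open>c2\<close> and \<open>c3\<close>. Total power increases strictly above \<open>c1\<close>,
    so comparing \<open>S\<close> with a threshold amounts to comparing \<open>t\<close> with a
    breakpoint; equality leaves the next stream at power 0.\<close>
  moreover have "c2 < t \<longleftrightarrow> S1 < S" "c3 < t \<longleftrightarrow> S2 < S"
    using S c_ord \<open>S > 0\<close> unfolding S12 by (simp_all add: max_def split: if_splits)
  ultimately show "S \<le> S1 \<Longrightarrow> n_streams \<psi> \<gamma> \<mu> = 1"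
    and "S1 < S \<Longrightarrow> S \<le> S2 \<Longrightarrow> n_streams \<psi> \<gamma> \<mu> = 2"
    and "S2 < S \<Longrightarrow> n_streams \<psi> \<gamma> \<mu> = 3"
    using c_ord unfolding n S12 by simp_all
qed

theorem mainTheorem3:
  fixes D L \<theta> S S1 S2 :: real and \<gamma> :: "nat \<Rightarrow> real"
  assumes "D > 0" and "L > 0" and "- pi / 2 < \<theta>" and "\<theta> < pi / 2" and "S > 0"
    and "ordered_eigenvalues3 (W33 D L \<theta>) \<gamma>"
    and "S1 = psi2 D L \<theta> / \<gamma> 2 - psi2 D L \<theta> / \<gamma> 1"
    and "S2 = 2 * psi2 D L \<theta> / \<gamma> 3 - psi2 D L \<theta> / \<gamma> 1 - psi2 D L \<theta> / \<gamma> 2"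
  shows "(\<forall>i\<in>{1..3}. \<gamma> i > 0) \<and>
    S1 = (psi2 D L \<theta> * Delta D L \<theta> - 1) / (psi2 D L \<theta> * Delta D L \<theta> + 1) \<and>
    S2 = (psi2 D L \<theta> * Delta D L \<theta> - 1) / (psi2 D L \<theta> * Delta D L \<theta> + 1)
         + 8 * psi2 D L \<theta> * Delta D L \<theta> / ((psi2 D L \<theta> * Delta D L \<theta>)\<^sup>2 - 1) \<and>
    (\<exists>!\<mu>. waterfilling_solution S (psi2 D L \<theta>) \<gamma> \<mu>) \<and>
    (\<forall>\<mu>. waterfilling_solution S (psi2 D L \<theta>) \<gamma> \<mu> \<longrightarrow>
      (S \<le> S1 \<longrightarrow> n_streams (psi2 D L \<theta>) \<gamma> \<mu> = 1) \<and>
      (S1 < S \<and> S \<le> S2 \<longrightarrow> n_streams (psi2 D L \<theta>) \<gamma> \<mu> = 2) \<and>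
      (S2 < S \<longrightarrow> n_streams (psi2 D L \<theta>) \<gamma> \<mu> = 3))"
proof -
  define \<psi> \<Delta> u where "\<psi> = psi2 D L \<theta>" and "\<Delta> = Delta D L \<theta>" and "u = \<psi> * \<Delta>"
  have cos: "cos \<theta> > 0"
    using assms(3,4) by (intro cos_gt_zero_pi) auto
  have \<Delta>: "\<Delta> > 0" and u: "u > 1"
    using Delta_pos[OF assms(1,2) cos] psi2_Delta_gt_1[OF assms(1,2) cos]
    by (simp_all add: \<psi>_def \<Delta>_def u_def)
  have \<psi>: "\<psi> > 0" and less: "1 / \<Delta> < \<psi>"
    using u \<Delta> zero_less_mult_pos2[of \<psi> \<Delta>] by (simp_all add: u_def divide_less_eq)
  \<comment> \<open>The inequality 1 / \<Delta> < \<psi> puts \<psi> above the larger eigenvalue of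
    the lower block; it also makes the smaller one positive below.\<close>
  have \<gamma>: "\<gamma> 1 = \<psi>" "\<gamma> 2 = (\<psi> + 1 / \<Delta>) / 2" "\<gamma> 3 = (\<psi> - 1 / \<Delta>) / 2"
    using ordered_eigenvalues3_unique[OF assms(6)
        W33_eigenvalues[OF assms(1,2) cos, folded \<psi>_def \<Delta>_def]] \<Delta> less
    by simp_all
  have c1: "\<psi> / \<gamma> 1 = 1"
    unfolding \<gamma> using \<psi> by simp
  have c2: "\<psi> / \<gamma> 2 = 2 * u / (u + 1)"
    unfolding \<gamma> u_def using \<Delta> by (simp add: field_simps)
  have c3: "\<psi> / \<gamma> 3 = 2 * u / (u - 1)"
    unfolding \<gamma> u_def using \<Delta> by (simp add: field_simps)
  have le: "\<psi> / \<gamma> 1 \<le> \<psi> / \<gamma> 2" "\<psi> / \<gamma> 2 \<le> \<psi> / \<gamma> 3"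
    unfolding c1 c2 c3 using u by (simp_all add: field_simps)
  have pos: "\<forall>i\<in>{1..3}. \<gamma> i > 0"
  proof -
    have "1 / \<Delta> > 0"
      using \<Delta> by simp
    then have "\<gamma> 1 > 0" "\<gamma> 2 > 0" "\<gamma> 3 > 0"
      unfolding \<gamma> using \<psi> less by (simp_all add: add_pos_pos)
    moreover have "{1..3} = {1, 2, 3 :: nat}" by auto
    ultimately show ?thesis by simp
  qed
  have S1: "S1 = (u - 1) / (u + 1)"
    using u unfolding assms(7) \<psi>_def[symmetric] c1 c2 by (simp add: field_simps)
  have "S2 = 2 * (\<psi> / \<gamma> 3) - \<psi> / \<gamma> 1 - \<psi> / \<gamma> 2"
    by (simp add: assms(8) \<psi>_def)
  \<comment> \<open>From the second breakpoint to the third, two streams fill at once, so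
    \<open>S2\<close> exceeds \<open>S1\<close> by twice the gap 2u / (u - 1) - 2u / (u + 1) = 4u /
    ((u - 1)(u + 1)).\<close>
  also have "\<dots> = (u - 1) / (u + 1) + 8 * u / ((u - 1) * (u + 1))"
    using u unfolding c1 c2 c3 by (simp add: divide_simps) (simp add: algebra_simps)
  also have "(u - 1) * (u + 1) = u\<^sup>2 - 1"
    by (simp add: power2_eq_square algebra_simps)
  finally have S2: "S2 = (u - 1) / (u + 1) + 8 * u / (u\<^sup>2 - 1)" .
  have "0 < \<psi> / \<gamma> 1"
    unfolding c1 by simp
  then have ex1: "\<exists>!\<mu>. waterfilling_solution S \<psi> \<gamma> \<mu>"
    using le \<open>S > 0\<close> by (rule ex1_waterfilling_solution)
  have streams: "\<forall>\<mu>. waterfilling_solution S \<psi> \<gamma> \<mu> \<longrightarrow>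
      (S \<le> S1 \<longrightarrow> n_streams \<psi> \<gamma> \<mu> = 1) \<and>
      (S1 < S \<and> S \<le> S2 \<longrightarrow> n_streams \<psi> \<gamma> \<mu> = 2) \<and>
      (S2 < S \<longrightarrow> n_streams \<psi> \<gamma> \<mu> = 3)"
    using n_streams_thresholds[OF le \<open>S > 0\<close>]
    unfolding assms(7,8) \<psi>_def[symmetric] by metis
  \<comment> \<open>The goal parses as (8 * \<psi>) * \<Delta>, which does not contain the product
    \<psi> * \<Delta> literally, so folding \<open>u\<close> needs this regrouping.\<close>
  have u8: "8 * \<psi> * \<Delta> = 8 * u"
    by (simp add: u_def)
  show ?thesis
    unfolding \<psi>_def[symmetric] \<Delta>_def[symmetric] u8 u_def[symmetric]
    by (rule conjI[OF pos conjI[OF S1 conjI[OF S2 conjI[OF ex1 streams]]]])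
qed

end
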